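(* (i) For any loopless matroid $M$ on a nonempty finite set $E$ there exists a polynomial $p_M(x)\in x\mathbb{Z}[x]$ such that for every positive integer $k$ the number of Gallai $k$-colorings of $M$ equals $p_M(k)$. Specifically, $p_M(x)=\sum_{j\ge 1} a_j\,(x)_j$, where $(x)_j:=x(x-1)\cdots(x-j+1)$ and $a_j$ is the number of Gallai $j$-partitions of $M$. (ii) For any acyclic oriented matroid $M$ on a nonempty finite set $E$ there exists a polynomial $p_M(x)\in x\mathbb{Z}[x]$ such that for every positive integer $k$ the number of transitive $k$-colorings of $M$ equals $p_M(k)$. Specifically, $p_M(x)=\sum_{j\ge 1} a_j\,(x)_j$, where $a_j$ is the number of transitive $j$-partitions of $M$.
   Context: A matroid is loopless if it has no circuit of size 1; an oriented matroid is acyclic if it has no positive circuit (no signed circuit with $X^-=\varnothing$). Write $[k]=\{1,\dots,k\}$. A Gallai $k$-coloring of a matroid $M$ on $E$ is a function $\varepsilon:E\to[k]$ such that $|\varepsilon(X)|<|X|$ for every circuit $X$. A Gallai $k$-partition of $M$ is a (unordered) partition of $E$ into $k$ disjoint nonempty blocks $B_1,\dots,B_k$ such that for every circuit $X$, $|X\cap B_i|\ge 2$ for at least one $i$. A transitive $k$-coloring of an oriented matroid $M$ on $E$ is a function $\varepsilon:E\to[k]$ such that $\varepsilon(X^+)\cap\varepsilon(X^-)\ne\varnothing$ for every signed circuit $X=(X^+,X^-)$. A transitive $k$-partition of $M$ is a (unordered) partition of $E$ into $k$ disjoint nonempty blocks $B_1,\dots,B_k$ such that for every signed circuit $X=(X^+,X^-)$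 there is at least one $i$ with both $X^+\cap B_i\ne\varnothing$ and $X^-\cap B_i\ne\varnothing$. *)

theory Defs
  imports
    "HOL-Library.FuncSet"
    "HOL-Library.Disjoint_Sets"
    "HOL-Computational_Algebra.Polynomial"
begin

text \<open>A matroid on a finite ground set, given by its collection of circuits.\<close>

locale matroid =
  fixes E :: "'a set" and \<C> :: "'a set set"
  assumes finite_ground: "finite E"
    and circuit_subset: "X \<in> \<C> \<Longrightarrow> X \<subseteq> E"
    and circuit_nonempty: "{} \<notin> \<C>"
    and circuit_incomparable: "\<lbrakk>X \<in> \<C>; Y \<in> \<C>; X \<subseteq> Y\<rbrakk> \<Longrightarrow> X = Y"
    and circuit_elimination:
      "\<lbrakk>X \<in> \<C>; Y \<in> \<C>; X \<noteq> Y; e \<in> X \<inter> Y\<rbrakk> \<Longrightarrow> \<exists>Z\<in>\<C>. Z \<subseteq> (X \<union> Y) - {e}"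

definition loopless :: "'a set set \<Rightarrow> bool" where
  "loopless \<C> \<longleftrightarrow> (\<forall>X\<in>\<C>. card X \<noteq> 1)"

text \<open>
  An oriented matroid on a finite ground set, given by its collection of signed circuits.
  The signed set \<open>X = (X\<^sup>+, X\<^sup>-)\<close> is the pair \<open>(fst X, snd X)\<close>, and \<open>- X\<close> is \<open>prod.swap X\<close>.
\<close>

locale oriented_matroid =
  fixes E :: "'a set" and \<S> :: "('a set \<times> 'a set) set"
  assumes finite_ground: "finite E"
    and signed_circuit_subset: "X \<in> \<S> \<Longrightarrow> fst X \<union> snd X \<subseteq> E"
    and signed_circuit_disjoint: "X \<in> \<S> \<Longrightarrow> fst X \<inter> snd X = {}"
    and signed_circuit_nonempty: "({}, {}) \<notin> \<S>"
    and signed_circuit_symmetric: "X \<in> \<S> \<Longrightarrow> prod.swap X \<in> \<S>"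
    and signed_circuit_incomparable:
      "\<lbrakk>X \<in> \<S>; Y \<in> \<S>; fst X \<union> snd X \<subseteq> fst Y \<union> snd Y\<rbrakk> \<Longrightarrow> X = Y \<or> X = prod.swap Y"
    and signed_circuit_elimination:
      "\<lbrakk>X \<in> \<S>; Y \<in> \<S>; X \<noteq> prod.swap Y; e \<in> fst X \<inter> snd Y\<rbrakk> \<Longrightarrow>
        \<exists>Z\<in>\<S>. fst Z \<subseteq> (fst X \<union> fst Y) - {e} \<and> snd Z \<subseteq> (snd X \<union> snd Y) - {e}"

definition acyclic_signed :: "('a set \<times> 'a set) set \<Rightarrow> bool" where
  "acyclic_signed \<S> \<longleftrightarrow> \<not> (\<exists>X\<in>\<S>. snd X = {})"

text \<open>
  Functions \<open>E \<rightarrow> [k]\<close> are taken as extensional functions, so that they can be counted.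
\<close>

definition gallai_colorings :: "'a set \<Rightarrow> 'a set set \<Rightarrow> nat \<Rightarrow> ('a \<Rightarrow> nat) set" where
  "gallai_colorings E \<C> k =
    {\<epsilon> \<in> E \<rightarrow>\<^sub>E {1..k}. \<forall>X\<in>\<C>. card (\<epsilon> ` X) < card X}"

definition gallai_partitions :: "'a set \<Rightarrow> 'a set set \<Rightarrow> nat \<Rightarrow> 'a set set set" where
  "gallai_partitions E \<C> k =
    {P. partition_on E P \<and> card P = k \<and> (\<forall>X\<in>\<C>. \<exists>B\<in>P. card (X \<inter> B) \<ge> 2)}"

definition transitive_colorings ::
    "'a set \<Rightarrow> ('a set \<times> 'a set) set \<Rightarrow> nat \<Rightarrow> ('a \<Rightarrow> nat) set" where
  "transitive_colorings E \<S> k =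
    {\<epsilon> \<in> E \<rightarrow>\<^sub>E {1..k}. \<forall>X\<in>\<S>. \<epsilon> ` fst X \<inter> \<epsilon> ` snd X \<noteq> {}}"

definition transitive_partitions ::
    "'a set \<Rightarrow> ('a set \<times> 'a set) set \<Rightarrow> nat \<Rightarrow> 'a set set set" where
  "transitive_partitions E \<S> k =
    {P. partition_on E P \<and> card P = k \<and>
        (\<forall>X\<in>\<S>. \<exists>B\<in>P. fst X \<inter> B \<noteq> {} \<and> snd X \<inter> B \<noteq> {})}"

text \<open>The falling factorial \<open>(x)\<^sub>j = x (x - 1) \<cdots> (x - j + 1)\<close> in \<open>\<int>[x]\<close>.\<close>

definition falling_factorial_poly :: "nat \<Rightarrow> int poly" where
  "falling_factorial_poly j = (\<Prod>i<j. [:- int i, 1:])"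

end

theory Submission
  imports Defs
begin

text \<open>
  A function is determined by its partition into fibres together with an injective choice of
  values on the blocks, so exactly \<open>(k)\<^sub>j\<close> functions into \<open>[k]\<close> have a given fibre partition with
  \<open>j\<close> blocks. Both kinds of colorings are characterised by a condition on the fibre partition
  alone, namely the one defining the corresponding partitions.
\<close>

text \<open>Indexing the fibres by points of \<open>E\<close> instead of by values keeps the empty
  fibre out, as \<open>partition_on\<close> demands.\<close>

definition fibres :: "'a set \<Rightarrow> ('a \<Rightarrow> 'b) \<Rightarrow> 'a set set" where
  "fibres E f = (\<lambda>x. {y \<in> E. f y = f x}) ` E"

lemma partition_on_fibres: "partition_on E (fibres E f)"
proof (rule partition_onI)
  fix B B' assume B: "B \<in> fibres E f" "B' \<in> fibres E f" "B \<noteq> B'"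
  obtain x x' where x: "B = {y \<in> E. f y = f x}" "B' = {y \<in> E. f y = f x'}"
    using B(1,2) unfolding fibres_def by blast
  with B(3) have "f x \<noteq> f x'" by auto
  with x show "disjnt B B'" by (auto simp: disjnt_def)
qed (auto simp: fibres_def)

text \<open>This trades an equation between set systems for a pointwise test. The blocks of
  \<open>P\<close> cover \<open>E\<close>, so every fibre is tested; they are nonempty, so every
  block is the fibre of one of its points.\<close>

lemma fibres_eq_iff:
  assumes "partition_on E P"
  shows "fibres E f = P \<longleftrightarrow> (\<forall>B\<in>P. \<forall>x\<in>B. {y \<in> E. f y = f x} = B)"
proof
  assume eq: "fibres E f = P"
  show "\<forall>B\<in>P. \<forall>x\<in>B. {y \<in> E. f y = f x} = B"
    unfolding eq[symmetric] fibres_def by auto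
next
  assume *: "\<forall>B\<in>P. \<forall>x\<in>B. {y \<in> E. f y = f x} = B"
  have E: "E = \<Union>P" and ne: "{} \<notin> P"
    using assms by (auto simp: partition_on_def)
  show "fibres E f = P"
  proof
    show "fibres E f \<subseteq> P"
      using * E unfolding fibres_def by fastforce
    show "P \<subseteq> fibres E f"
    proof
      fix B assume B: "B \<in> P"
      then obtain x where x: "x \<in> B" using ne by (metis ex_in_conv)
      then have "B = {y \<in> E. f y = f x}" "x \<in> E" using * B E by auto
      then show "B \<in> fibres E f" unfolding fibres_def by blast
    qed
  qed
qed

text \<open>An injective labelling \<open>g\<close> of the blocks becomes a function on
  \<open>E\<close> by giving each point the label of its block. Injectivity of \<open>g\<close> is
  exactly what prevents two blocks from merging into one fibre.\<close>

lemma bij_betw_inj_on_fibres: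
  assumes P: "partition_on E P"
  defines "block \<equiv> \<lambda>x. THE B. B \<in> P \<and> x \<in> B"
  shows "bij_betw (\<lambda>g. restrict (g \<circ> block) E)
           {g \<in> P \<rightarrow>\<^sub>E K. inj_on g P} {f \<in> E \<rightarrow>\<^sub>E K. fibres E f = P}"
proof -
  have E: "E = \<Union>P" and ne: "{} \<notin> P" and disj: "disjoint P"
    using P by (auto simp: partition_on_def)
  have block: "block x = B" if "B \<in> P" "x \<in> B" for x B
    unfolding block_def using that disj by (auto simp: disjoint_def intro!: the_equality)
  \<comment> \<open>One arbitrary point per block. A function with fibre partition \<open>P\<close>
    is constant on each block, so the choice does not affect the value read there.\<close>
  define rep where "rep B = (SOME x. x \<in> B)" for B :: "'a set"
  have rep: "rep B \<in> B" if "B \<in> P" for B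
    using that ne unfolding rep_def by (metis ex_in_conv someI)
  \<comment> \<open>The inverse reads the label of a block off its representative. Both maps are
    restricted, so the two composites are the identity also outside \<open>P\<close> and
    \<open>E\<close>, where extensional functions are \<open>undefined\<close>.\<close>
  show ?thesis
  proof (rule bij_betw_byWitness[where f' = "\<lambda>f. restrict (f \<circ> rep) P"])
    show "\<forall>g\<in>{g \<in> P \<rightarrow>\<^sub>E K. inj_on g P}. restrict (restrict (g \<circ> block) E \<circ> rep) P = g"
    proof
      fix g assume g: "g \<in> {g \<in> P \<rightarrow>\<^sub>E K. inj_on g P}"
      show "restrict (restrict (g \<circ> block) E \<circ> rep) P = g"
      proof
        fix B
        show "restrict (restrict (g \<circ> block) E \<circ> rep) P B = g B"
          using g rep[of B] block[of B "rep B"] E by (cases "B \<in> P") auto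
      qed
    qed
    show "\<forall>f\<in>{f \<in> E \<rightarrow>\<^sub>E K. fibres E f = P}. restrict (restrict (f \<circ> rep) P \<circ> block) E = f"
    proof
      fix f assume f: "f \<in> {f \<in> E \<rightarrow>\<^sub>E K. fibres E f = P}"
      show "restrict (restrict (f \<circ> rep) P \<circ> block) E = f"
      proof
        fix x
        show "restrict (restrict (f \<circ> rep) P \<circ> block) E x = f x"
        proof (cases "x \<in> E")
          case True
          then obtain B where B: "B \<in> P" "x \<in> B" using E by blast
          have "{y \<in> E. f y = f x} = B"
            using f B fibres_eq_iff[OF P, of f] by blast
          then have "f (rep B) = f x" using rep[OF B(1)] by blast
          then show ?thesis using True B block[OF B] by simp
        qed (use f in auto)
      qed
    qed
    show "(\<lambda>g. restrict (g \<circ> block) E) ` {g \<in> P \<rightarrow>\<^sub>E K. inj_on g P}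
            \<subseteq> {f \<in> E \<rightarrow>\<^sub>E K. fibres E f = P}"
    proof (rule image_subsetI)
      fix g assume g: "g \<in> {g \<in> P \<rightarrow>\<^sub>E K. inj_on g P}"
      have "restrict (g \<circ> block) E x \<in> K" if "x \<in> E" for x
        using that g E block by fastforce
      then have "restrict (g \<circ> block) E \<in> E \<rightarrow>\<^sub>E K" by auto
      moreover have "{y \<in> E. restrict (g \<circ> block) E y = restrict (g \<circ> block) E x} = B"
        if B: "B \<in> P" "x \<in> B" for B x
      proof -
        \<comment> \<open>Here injectivity of \<open>g\<close> enters: a point with the label of
          \<open>B\<close> lies in a block with that label, hence in \<open>B\<close>.\<close>
        have "g (block y) = g B \<longleftrightarrow> y \<in> B" if y: "y \<in> E" for y
        proof -
          obtain B' where B': "B' \<in> P" "y \<in> B'" using y E by blast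
          then show ?thesis using g B block[OF B'] block[of B y] by (auto simp: inj_on_def)
        qed
        then show ?thesis using B E block[OF B] by auto
      qed
      ultimately show "restrict (g \<circ> block) E \<in> {f \<in> E \<rightarrow>\<^sub>E K. fibres E f = P}"
        unfolding mem_Collect_eq fibres_eq_iff[OF P] by blast
    qed
    show "(\<lambda>f. restrict (f \<circ> rep) P) ` {f \<in> E \<rightarrow>\<^sub>E K. fibres E f = P}
            \<subseteq> {g \<in> P \<rightarrow>\<^sub>E K. inj_on g P}"
    proof (rule image_subsetI)
      fix f assume f: "f \<in> {f \<in> E \<rightarrow>\<^sub>E K. fibres E f = P}"
      have fib: "{y \<in> E. f y = f (rep B)} = B" if "B \<in> P" for B
        using f rep[OF that] that fibres_eq_iff[OF P, of f] by blast
      \<comment> \<open>Each block is the whole fibre through its representative, so representatives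
        with equal values have equal blocks.\<close>
      have "B = B'" if "B \<in> P" "B' \<in> P" "f (rep B) = f (rep B')" for B B'
        using fib[OF that(1)] fib[OF that(2), folded that(3)] by (rule trans[OF sym])
      moreover have "f (rep B) \<in> K" if "B \<in> P" for B
      proof -
        have "rep B \<in> E" using rep[OF that] that E by blast
        then show ?thesis using f by (auto dest: PiE_mem)
      qed
      ultimately show "restrict (f \<circ> rep) P \<in> {g \<in> P \<rightarrow>\<^sub>E K. inj_on g P}"
        by (auto simp: inj_on_def)
    qed
  qed
qed

text \<open>Subtraction on the right is truncated. For \<open>j\<close> \<le> \<open>k\<close> no
  truncation occurs; for \<open>j\<close> > \<open>k\<close> both products contain the factor with
  index \<open>k\<close>, which is 0.\<close>

lemma poly_falling_factorial:
  "poly (falling_factorial_poly j) (int k) = int (\<Prod>i<j. k - i)"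
proof (cases "j \<le> k")
  case True
  then show ?thesis
    by (auto simp: falling_factorial_poly_def poly_prod of_nat_diff intro!: prod.cong)
next
  case False
  then have "k \<in> {..<j}" by simp
  then have "(\<Prod>i<j. k - i) = 0" "(\<Prod>i<j. int k - int i) = 0"
    by (metis diff_self_eq_0 finite_lessThan prod_zero, metis diff_self finite_lessThan prod_zero)
  then show ?thesis
    unfolding falling_factorial_poly_def poly_prod by (simp only:) simp
qed

text \<open>The factor with index 0 is x itself; it is present as soon as \<open>j\<close> is
  positive.\<close>

lemma dvd_falling_factorial_poly:
  assumes "j \<ge> 1"
  shows "[:0, 1:] dvd falling_factorial_poly j"
proof -
  have "[:- int 0, 1:] dvd (\<Prod>i<j. [:- int i, 1:])"
    using assms by (intro dvd_prodI) auto
  then show ?thesis by (simp add: falling_factorial_poly_def)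
qed

text \<open>The count reduces to that of injections from \<open>P\<close> into
  \<open>{1..k}\<close>. If \<open>P\<close> has more than \<open>k\<close> blocks, both sides are
  0.\<close>

lemma card_fibres_eq:
  assumes "finite E" "partition_on E P"
  shows "int (card {f \<in> E \<rightarrow>\<^sub>E {1..k}. fibres E f = P}) =
           poly (falling_factorial_poly (card P)) (int k)"
proof -
  have "card {f \<in> E \<rightarrow>\<^sub>E {1..k}. fibres E f = P} = card {g \<in> P \<rightarrow>\<^sub>E {1..k}. inj_on g P}"
    using bij_betw_same_card[OF bij_betw_inj_on_fibres[OF assms(2)]] by metis
  also have "\<dots> = (\<Prod>i<card P. k - i)"
    using card_inj_on_subset_funcset[of P "{1..k}" P] finite_elements[OF assms]
    by (simp add: lessThan_atLeast0)
  finally show ?thesis by (simp only: poly_falling_factorial)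
qed

text \<open>The predicate \<open>Q\<close> on partitions abstracts from the two kinds of colorings,
  so that one count serves both. Summing over the indices with nonzero coefficient makes the
  formally infinite sum over j a finite one.\<close>

lemma coloring_polynomial:
  fixes E :: "'a set"
  assumes fin: "finite E" and ne: "E \<noteq> {}"
    and col: "\<And>k. col k = {f \<in> E \<rightarrow>\<^sub>E {1..k}. Q (fibres E f)}"
    and part: "\<And>j. part j = {P. partition_on E P \<and> card P = j \<and> Q P}"
  shows "\<exists>p :: int poly. [:0, 1:] dvd p \<and>
    (\<forall>k\<ge>1. int (card (col k)) = poly p (int k)) \<and>
    finite {j. j \<ge> 1 \<and> card (part j) \<noteq> 0} \<and>
    p = (\<Sum>j | j \<ge> 1 \<and> card (part j) \<noteq> 0.
           smult (int (card (part j))) (falling_factorial_poly j))"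
proof -
  define \<P> where "\<P> = {P. partition_on E P \<and> Q P}"
  have fin\<P>: "finite \<P>"
    unfolding \<P>_def using finitely_many_partition_on[OF fin] by (rule rev_finite_subset) auto
  have part': "part j = {P \<in> \<P>. card P = j}" for j
    unfolding part \<P>_def by auto
  \<comment> \<open>A nonempty ground set rules out the empty partition. Hence no constant term
    (x)_0 = 1 occurs, which later yields divisibility by x.\<close>
  have card_pos: "card P \<ge> 1" if "P \<in> \<P>" for P
  proof -
    have P: "partition_on E P" using that by (simp add: \<P>_def)
    then have "P \<noteq> {}" using ne by (auto simp: partition_on_def)
    then show ?thesis
      using finite_elements[OF fin P] by (simp add: Suc_le_eq card_gt_0_iff)
  qed
  define J where "J = {j. j \<ge> 1 \<and> card (part j) \<noteq> 0}"
  \<comment> \<open>Since \<open>\<P>\<close> is finite, a nonzero \<open>card\<close> means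
    nonempty, so the relevant indices are the block numbers that occur.\<close>
  have J: "J = card ` \<P>"
    using fin\<P> card_pos by (auto simp: J_def part' image_iff)
  have finJ: "finite J" using J fin\<P> by simp
  define p where "p = (\<Sum>j\<in>J. smult (int (card (part j))) (falling_factorial_poly j))"
  \<comment> \<open>Grouping the partitions by block number turns the coefficient of each falling
    factorial into one summand per partition.\<close>
  have p: "p = (\<Sum>P\<in>\<P>. falling_factorial_poly (card P))"
  proof -
    have "(\<Sum>P\<in>\<P>. falling_factorial_poly (card P)) =
        (\<Sum>j\<in>J. \<Sum>P\<in>{P \<in> \<P>. card P = j}. falling_factorial_poly (card P))"
      by (rule sum.group[symmetric]) (use fin\<P> finJ J in auto)
    also have "\<dots> = p"
      unfolding p_def by (intro sum.cong) (auto simp: part' of_nat_poly)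
    finally show ?thesis ..
  qed
  have "int (card (col k)) = poly p (int k)" for k
  proof -
    \<comment> \<open>The colorings are sorted by fibre partition; the classes are disjoint because
      a function has only one such partition.\<close>
    have "col k = (\<Union>P\<in>\<P>. {f \<in> E \<rightarrow>\<^sub>E {1..k}. fibres E f = P})"
      unfolding col \<P>_def using partition_on_fibres by blast
    also have "card \<dots> = (\<Sum>P\<in>\<P>. card {f \<in> E \<rightarrow>\<^sub>E {1..k}. fibres E f = P})"
      by (rule card_UN_disjoint) (use fin\<P> finite_PiE[OF fin, of "\<lambda>_. {1..k}"] in auto)
    finally have "int (card (col k)) = (\<Sum>P\<in>\<P>. int (card {f \<in> E \<rightarrow>\<^sub>E {1..k}. fibres E f = P}))"
      by (simp only: of_nat_sum)
    also have "\<dots> = (\<Sum>P\<in>\<P>. poly (falling_factorial_poly (card P)) (int k))"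
      by (intro sum.cong card_fibres_eq[OF fin] refl) (simp add: \<P>_def)
    finally show ?thesis by (simp only: p poly_sum)
  qed
  moreover have "[:0, 1:] dvd p"
    unfolding p using card_pos by (intro dvd_sum dvd_falling_factorial_poly)
  ultimately show ?thesis
    using finJ p_def unfolding J_def by blast
qed

lemma two_le_card_iff:
  assumes "finite A"
  shows "2 \<le> card A \<longleftrightarrow> (\<exists>x\<in>A. \<exists>y\<in>A. x \<noteq> y)"
proof -
  have "2 \<le> card A \<longleftrightarrow> \<not> card A \<le> Suc 0" by linarith
  then show ?thesis unfolding card_le_Suc0_iff_eq[OF assms] by blast
qed

text \<open>On a finite set, losing cardinality under \<open>f\<close> means failing injectivity,
  that is, two distinct points of \<open>X\<close> in one fibre.\<close>

lemma card_image_less_iff_fibres: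
  assumes "finite E" "X \<subseteq> E"
  shows "card (f ` X) < card X \<longleftrightarrow> (\<exists>B\<in>fibres E f. 2 \<le> card (X \<inter> B))"
proof -
  have fin: "finite X" using assms finite_subset by blast
  have "card (f ` X) < card X \<longleftrightarrow> \<not> inj_on f X"
    using card_image_le[OF fin, of f] inj_on_iff_eq_card[OF fin, of f] by linarith
  also have "\<dots> \<longleftrightarrow> (\<exists>B\<in>fibres E f. 2 \<le> card (X \<inter> B))"
    unfolding two_le_card_iff[OF finite_Int[OF disjI1[OF fin]]]
    using assms(2) by (fastforce simp: inj_on_def fibres_def)
  finally show ?thesis .
qed

text \<open>A value taken on both sets is the same thing as a fibre meeting both.\<close>

lemma images_intersect_iff_fibres:
  assumes "X \<subseteq> E" "Y \<subseteq> E"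
  shows "f ` X \<inter> f ` Y \<noteq> {} \<longleftrightarrow> (\<exists>B\<in>fibres E f. X \<inter> B \<noteq> {} \<and> Y \<inter> B \<noteq> {})"
proof
  assume "f ` X \<inter> f ` Y \<noteq> {}"
  then obtain x y where xy: "x \<in> X" "y \<in> Y" "f y = f x" by fastforce
  then have "{z \<in> E. f z = f x} \<in> fibres E f" "X \<inter> {z \<in> E. f z = f x} \<noteq> {}"
    "Y \<inter> {z \<in> E. f z = f x} \<noteq> {}"
    using assms by (auto simp: fibres_def)
  then show "\<exists>B\<in>fibres E f. X \<inter> B \<noteq> {} \<and> Y \<inter> B \<noteq> {}" by (intro bexI conjI)
next
  assume "\<exists>B\<in>fibres E f. X \<inter> B \<noteq> {} \<and> Y \<inter> B \<noteq> {}"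
  then obtain B x y where B: "B \<in> fibres E f" "x \<in> X" "x \<in> B" "y \<in> Y" "y \<in> B" by blast
  then have "f x = f y" by (auto simp: fibres_def)
  then have "f x \<in> f ` X \<inter> f ` Y" using B by (metis IntI imageI)
  then show "f ` X \<inter> f ` Y \<noteq> {}" by (metis empty_iff)
qed

theorem proposition1p15:
  shows "(\<forall>(E :: 'a set) (\<C> :: 'a set set).
      matroid E \<C> \<longrightarrow> E \<noteq> {} \<longrightarrow> loopless \<C> \<longrightarrow>
      (\<exists>p :: int poly. [:0, 1:] dvd p \<and>
        (\<forall>k\<ge>1. int (card (gallai_colorings E \<C> k)) = poly p (int k)) \<and>
        finite {j. j \<ge> 1 \<and> card (gallai_partitions E \<C> j) \<noteq> 0} \<and>
        p = (\<Sum>j | j \<ge> 1 \<and> card (gallai_partitions E \<C> j) \<noteq> 0.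
               smult (int (card (gallai_partitions E \<C> j))) (falling_factorial_poly j))))
    \<and> (\<forall>(E :: 'b set) (\<S> :: ('b set \<times> 'b set) set).
      oriented_matroid E \<S> \<longrightarrow> E \<noteq> {} \<longrightarrow> acyclic_signed \<S> \<longrightarrow>
      (\<exists>p :: int poly. [:0, 1:] dvd p \<and>
        (\<forall>k\<ge>1. int (card (transitive_colorings E \<S> k)) = poly p (int k)) \<and>
        finite {j. j \<ge> 1 \<and> card (transitive_partitions E \<S> j) \<noteq> 0} \<and>
        p = (\<Sum>j | j \<ge> 1 \<and> card (transitive_partitions E \<S> j) \<noteq> 0.
               smult (int (card (transitive_partitions E \<S> j))) (falling_factorial_poly j))))"
proof (intro conjI allI impI)
  fix E :: "'a set" and \<C> :: "'a set set"
  assume "matroid E \<C>" and ne: "E \<noteq> {}"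
  then interpret matroid E \<C> by simp
  show "\<exists>p :: int poly. [:0, 1:] dvd p \<and>
        (\<forall>k\<ge>1. int (card (gallai_colorings E \<C> k)) = poly p (int k)) \<and>
        finite {j. j \<ge> 1 \<and> card (gallai_partitions E \<C> j) \<noteq> 0} \<and>
        p = (\<Sum>j | j \<ge> 1 \<and> card (gallai_partitions E \<C> j) \<noteq> 0.
               smult (int (card (gallai_partitions E \<C> j))) (falling_factorial_poly j))"
    \<comment> \<open>\<open>Q\<close> is the block condition on circuits. Circuits lie in
      \<open>E\<close>, so the fibre criterion applies to each of them.\<close>
    by (rule coloring_polynomial
        [where Q = "\<lambda>P. \<forall>X\<in>\<C>. \<exists>B\<in>P. card (X \<inter> B) \<ge> 2", OF finite_ground ne])
      (auto simp: gallai_colorings_def gallai_partitions_def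
        card_image_less_iff_fibres[OF finite_ground circuit_subset])
next
  fix E :: "'b set" and \<S> :: "('b set \<times> 'b set) set"
  assume "oriented_matroid E \<S>" and ne: "E \<noteq> {}"
  then interpret oriented_matroid E \<S> by simp
  \<comment> \<open>Both halves of a signed circuit lie in \<open>E\<close>, hence are covered by
    the fibres.\<close>
  have *: "f ` fst X \<inter> f ` snd X \<noteq> {} \<longleftrightarrow> (\<exists>B\<in>fibres E f. fst X \<inter> B \<noteq> {} \<and> snd X \<inter> B \<noteq> {})"
    if "X \<in> \<S>" for X and f :: "'b \<Rightarrow> nat"
    using signed_circuit_subset[OF that] by (intro images_intersect_iff_fibres) auto
  show "\<exists>p :: int poly. [:0, 1:] dvd p \<and>
        (\<forall>k\<ge>1. int (card (transitive_colorings E \<S> k)) = poly p (int k)) \<and>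
        finite {j. j \<ge> 1 \<and> card (transitive_partitions E \<S> j) \<noteq> 0} \<and>
        p = (\<Sum>j | j \<ge> 1 \<and> card (transitive_partitions E \<S> j) \<noteq> 0.
               smult (int (card (transitive_partitions E \<S> j))) (falling_factorial_poly j))"
  proof (rule coloring_polynomial
      [where Q = "\<lambda>P. \<forall>X\<in>\<S>. \<exists>B\<in>P. fst X \<inter> B \<noteq> {} \<and> snd X \<inter> B \<noteq> {}", OF finite_ground ne])
    show "transitive_colorings E \<S> k = {f \<in> E \<rightarrow>\<^sub>E {1..k}.
        \<forall>X\<in>\<S>. \<exists>B\<in>fibres E f. fst X \<inter> B \<noteq> {} \<and> snd X \<inter> B \<noteq> {}}" for k
      unfolding transitive_colorings_def by (intro Collect_cong conj_cong ball_cong refl *)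
  qed (simp add: transitive_partitions_def)
qed

end
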